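(* Let $m$ be a positive integer and let $f:\mathbb{N}\to\mathbb{C}$ be a multiplicative function. Consider the following three conditions: (i) for some prime $q\mid m$, $\sum_{k=0}^\infty \frac{f(q^k)}{q^k}=0$; (ii) for each prime power $p^a\,\|\,m$ ($p$ prime), $f(p^k)=f(p^a)$ for all $k\geq a$; (iii) for each prime $p$ with $\gcd(p,m)=1$, $f(p^k)=1$ for all $k\geq 1$. If $f$ has period $m$, $f(m)\neq 0$ and $f$ has bounded partial sums, then (i), (ii) and (iii) are satisfied. Conversely, if (i), (ii) and (iii) are satisfied, then $f$ has period $m$ and has bounded partial sums.
   Context: $\mathbb{N}=\{1,2,3,\dots\}$. A function $f:\mathbb{N}\to\mathbb{C}$ is multiplicative if $f(1)=1$ and $f(nm)=f(n)f(m)$ whenever $n$ and $m$ are relatively prime. $f$ has period $m$ if $f(n+m)=f(n)$ for all $n\in\mathbb{N}$ ($m$ is not required to be the minimal period). $f$ has bounded partial sums if there exists a constant $C>0$ such that $|\sum_{n\leq x}f(n)|\leq C$ for all $x\geq 1$. The notation $p^a\,\|\,m$ means that $p^a$ is the largest power of $p$ dividing $m$. *)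

theory Defs
  imports Complex_Main "HOL-Computational_Algebra.Primes"
begin

text \<open>
  An arithmetic function on the positive integers is represented by a function on type
  \<open>nat\<close>; its value at \<open>0\<close> is junk, and every notion below is
  restricted to positive arguments so that none depends on it.
\<close>

definition multiplicative :: "(nat \<Rightarrow> complex) \<Rightarrow> bool" where
  "multiplicative f \<longleftrightarrow>
     f 1 = 1 \<and> (\<forall>n m. 0 < n \<longrightarrow> 0 < m \<longrightarrow> coprime n m \<longrightarrow> f (n * m) = f n * f m)"

text \<open>The period need not be minimal.\<close>

definition has_period :: "(nat \<Rightarrow> complex) \<Rightarrow> nat \<Rightarrow> bool" where
  "has_period f m \<longleftrightarrow> (\<forall>n>0. f (n + m) = f n)"

definition bounded_partial_sums :: "(nat \<Rightarrow> complex) \<Rightarrow> bool" where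
  "bounded_partial_sums f \<longleftrightarrow>
     (\<exists>C::real. C > 0 \<and> (\<forall>x::real. x \<ge> 1 \<longrightarrow> norm (\<Sum>n | 0 < n \<and> real n \<le> x. f n) \<le> C))"

text \<open>
  The equation asserts convergence of the series as well as the value of its sum.
\<close>

definition condition_i :: "nat \<Rightarrow> (nat \<Rightarrow> complex) \<Rightarrow> bool" where
  "condition_i m f \<longleftrightarrow>
     (\<exists>q. prime q \<and> q dvd m \<and> (\<lambda>k. f (q ^ k) / of_nat (q ^ k)) sums 0)"

text \<open>
  For a prime \<open>p\<close> and \<open>m > 0\<close>, the largest power of \<open>p\<close> dividing \<open>m\<close> is
  \<open>p ^ multiplicity p m\<close>. Prime powers have positive exponent, so only the primes
  dividing \<open>m\<close> are constrained here.
\<close>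

definition condition_ii :: "nat \<Rightarrow> (nat \<Rightarrow> complex) \<Rightarrow> bool" where
  "condition_ii m f \<longleftrightarrow>
     (\<forall>p a. prime p \<longrightarrow> a \<ge> 1 \<longrightarrow> multiplicity p m = a \<longrightarrow> (\<forall>k\<ge>a. f (p ^ k) = f (p ^ a)))"

definition condition_iii :: "nat \<Rightarrow> (nat \<Rightarrow> complex) \<Rightarrow> bool" where
  "condition_iii m f \<longleftrightarrow>
     (\<forall>p. prime p \<longrightarrow> gcd p m = 1 \<longrightarrow> (\<forall>k\<ge>1. f (p ^ k) = 1))"

end

theory Submission
  imports Defs "HOL-Number_Theory.Totient"
begin

text \<open>
  Under either set of hypotheses \<open>f n\<close> depends on \<open>n\<close> only through \<open>gcd n m\<close>, and the partial
  sums are then governed by the single number \<open>G m\<close>, where \<open>G n = (\<Sum>k = 1..n. f (gcd k n))\<close>.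

  A function of period \<open>m\<close> has bounded partial sums exactly when its sum over one period
  vanishes, since every further period adds that sum once more; here the sum over a period is
  \<open>G m\<close>.  Counting the \<open>k \<le> n\<close> with a given greatest common divisor shows that \<open>G\<close> is the
  Dirichlet convolution of \<open>f\<close> with Euler's totient, so \<open>G\<close> is multiplicative and \<open>G m\<close> is the
  product of the \<open>G (p ^ a)\<close> over the prime powers \<open>p ^ a\<close> exactly dividing \<open>m\<close>.  Because
  \<open>f (p ^ k)\<close> is constant for \<open>k \<ge> a\<close>, summing a geometric tail identifies \<open>G (p ^ a)\<close>, up to the
  nonzero factor \<open>p ^ a * (1 - 1 / p)\<close>, with the series \<open>\<Sum>k. f (p ^ k) / p ^ k\<close>.  Hence bounded
  partial sums mean precisely that one of these series vanishes.

  Conditions (ii) and (iii) express the dependence on \<open>gcd n m\<close> prime by prime.  They follow from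
  periodicity and \<open>f m \<noteq> 0\<close> because \<open>f (k * m) = f m\<close> for every \<open>k > 0\<close>: taking \<open>k\<close> to be a power
  of a prime \<open>p\<close> and cancelling the value of \<open>f\<close> at the part of \<open>m\<close> prime to \<open>p\<close> determines
  \<open>f\<close> on high powers of \<open>p\<close>.
\<close>

section \<open>Multiplicative functions and prime powers\<close>

lemma multiplicative_one: "multiplicative f \<Longrightarrow> f 1 = 1"
  by (simp add: multiplicative_def)

lemma multiplicative_mult:
  assumes "multiplicative f" "n > 0" "m > 0" "coprime n m"
  shows "f (n * m) = f n * f m"
  using assms by (simp add: multiplicative_def)

lemma multiplicative_prod_coprime:
  assumes f: "multiplicative f" and "finite A" and "\<And>x. x \<in> A \<Longrightarrow> h x > 0"
    and "\<And>x y. x \<in> A \<Longrightarrow> y \<in> A \<Longrightarrow> x \<noteq> y \<Longrightarrow> coprime (h x) (h y)"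
  shows "f (\<Prod>x\<in>A. h x) = (\<Prod>x\<in>A. f (h x))"
  using assms(2-4)
proof (induction A rule: finite_induct)
  case empty
  then show ?case using multiplicative_one[OF f] by simp
next
  case (insert x A)
  have "coprime (h x) (\<Prod>y\<in>A. h y)"
    using insert.hyps insert.prems(2) by (intro prod_coprime_right) auto
  moreover have "(\<Prod>y\<in>A. h y) > 0"
    using insert.prems(1) by (intro prod_pos) auto
  ultimately show ?case
    using insert by (simp add: multiplicative_mult[OF f])
qed

text \<open>
  The index set may be any finite set of primes containing those that divide \<open>n\<close>, the extra
  factors being \<open>f 1 = 1\<close>; so two numbers can be compared over a common set of primes.
\<close>

lemma multiplicative_prime_factorization:
  assumes f: "multiplicative f" and "n > 0"
    and A: "finite A" "prime_factors n \<subseteq> A" "\<And>p. p \<in> A \<Longrightarrow> prime p"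
  shows "f n = (\<Prod>p\<in>A. f (p ^ multiplicity p n))"
proof -
  have "n = (\<Prod>p\<in>prime_factors n. p ^ multiplicity p n)"
    using \<open>n > 0\<close> by (rule prime_factorization_nat)
  also have "\<dots> = (\<Prod>p\<in>A. p ^ multiplicity p n)"
    using A \<open>n > 0\<close>
    by (intro prod.mono_neutral_left) (auto simp: prime_factors_multiplicity)
  finally have "f n = f (\<Prod>p\<in>A. p ^ multiplicity p n)"
    by simp
  also have "\<dots> = (\<Prod>p\<in>A. f (p ^ multiplicity p n))"
  proof (rule multiplicative_prod_coprime[OF f])
    show "p ^ multiplicity p n > 0" if "p \<in> A" for p
      using A(3)[OF that] by (simp add: prime_gt_0_nat)
    show "coprime (p ^ multiplicity p n) (q ^ multiplicity q n)"
      if "p \<in> A" "q \<in> A" "p \<noteq> q" for p q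
      using that A(3) by (simp add: primes_coprime)
  qed (use A in auto)
  finally show ?thesis .
qed

text \<open>
  A prime not dividing \<open>m\<close> contributes the factor \<open>1\<close> to \<open>f n\<close>, and a prime power \<open>p ^ a\<close> exactly
  dividing \<open>m\<close> cuts the exponent of \<open>p\<close> in \<open>n\<close> off at \<open>a\<close>, as taking the greatest common
  divisor with \<open>m\<close> does.
\<close>

lemma conditions_imp_depends_on_gcd:
  assumes f: "multiplicative f" and "m > 0" and ii: "condition_ii m f" and iii: "condition_iii m f"
    and "n > 0"
  shows "f n = f (gcd n m)"
proof -
  have factor: "f (p ^ multiplicity p n) = f (p ^ multiplicity p (gcd n m))"
    if p: "prime p" for p
  proof (cases "p dvd m")
    case True
    then have "multiplicity p m \<ge> 1"
      using p \<open>m > 0\<close> by (simp add: prime_multiplicity_gt_zero_iff Suc_le_eq)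
    then have const: "f (p ^ k) = f (p ^ multiplicity p m)" if "k \<ge> multiplicity p m" for k
      using ii p that unfolding condition_ii_def by blast
    have "multiplicity p (gcd n m) = min (multiplicity p n) (multiplicity p m)"
      using \<open>m > 0\<close> \<open>n > 0\<close> p by (intro multiplicity_gcd) auto
    then show ?thesis
      using const[of "multiplicity p n"] by (auto simp: min_def)
  next
    case False
    then have "gcd p m = 1"
      using p by (simp add: prime_imp_coprime flip: coprime_iff_gcd_eq_1)
    then have one: "f (p ^ k) = 1" for k
      using iii p multiplicative_one[OF f] unfolding condition_iii_def
      by (cases "k = 0") auto
    then show ?thesis by simp
  qed
  have "f n = (\<Prod>p\<in>prime_factors n. f (p ^ multiplicity p n))"
    using f \<open>n > 0\<close> by (intro multiplicative_prime_factorization) auto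
  also have "\<dots> = (\<Prod>p\<in>prime_factors n. f (p ^ multiplicity p (gcd n m)))"
    by (intro prod.cong refl factor) auto
  also have "\<dots> = f (gcd n m)"
    using f \<open>n > 0\<close>
    by (intro multiplicative_prime_factorization[symmetric] dvd_prime_factors) auto
  finally show ?thesis .
qed

section \<open>Values at multiples of a period\<close>

lemma has_period_multiple:
  assumes "has_period f m" "m > 0" "k > 0"
  shows "f (k * m) = f m"
  using \<open>k > 0\<close>
proof (induction k rule: nat_induct_non_zero)
  case (Suc k)
  then have "f (k * m + m) = f (k * m)"
    using assms(1,2) by (simp add: has_period_def)
  then show ?case
    using Suc.IH by (simp add: add.commute)
qed simp

text \<open>
  If \<open>p ^ a\<close> exactly divides \<open>m = p ^ a * r\<close>, then \<open>p ^ k * r\<close> is a multiple of \<open>m\<close> for \<open>k \<ge> a\<close>,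
  so \<open>f (p ^ k) * f r = f m = f (p ^ a) * f r\<close>, and the factor \<open>f r\<close> of the nonzero number
  \<open>f m\<close> can be cancelled.
\<close>

lemma has_period_imp_prime_power_const:
  assumes f: "multiplicative f" and per: "has_period f m" and "m > 0" and nz: "f m \<noteq> 0"
    and p: "prime p" and k: "k \<ge> multiplicity p m"
  shows "f (p ^ k) = f (p ^ multiplicity p m)"
proof -
  define a where "a = multiplicity p m"
  obtain r where r: "m = p ^ a * r" "\<not> p dvd r"
    using multiplicity_decompose'[of m p] p \<open>m > 0\<close> unfolding a_def
    by (metis not_prime_unit neq0_conv)
  have "r > 0" and "p > 0"
    using r \<open>m > 0\<close> p by (auto simp: prime_gt_0_nat intro: Nat.gr0I)
  have "coprime p r"
    using p r(2) by (rule prime_imp_coprime)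
  then have split: "f (p ^ j * r) = f (p ^ j) * f r" for j
    using \<open>r > 0\<close> \<open>p > 0\<close> by (intro multiplicative_mult[OF f]) auto
  have "p ^ k = p ^ (k - a) * p ^ a"
    using k by (simp add: a_def flip: power_add)
  then have "p ^ k * r = p ^ (k - a) * m"
    by (subst r(1)) (simp only: mult.assoc)
  then have "f (p ^ k * r) = f m"
    using has_period_multiple[OF per \<open>m > 0\<close>] \<open>p > 0\<close> by simp
  then have "f (p ^ k) * f r = f (p ^ a) * f r"
    using split r(1) by metis
  moreover have "f r \<noteq> 0"
    using nz split[of a] r(1) by auto
  ultimately show ?thesis
    by (simp add: a_def)
qed

lemma has_period_imp_condition_ii:
  assumes "multiplicative f" "has_period f m" "m > 0" "f m \<noteq> 0"
  shows "condition_ii m f"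
  unfolding condition_ii_def using has_period_imp_prime_power_const[OF assms] by blast

lemma has_period_imp_condition_iii:
  assumes f: "multiplicative f" and "has_period f m" "m > 0" "f m \<noteq> 0"
  shows "condition_iii m f"
  unfolding condition_iii_def
proof (intro allI impI)
  fix p k :: nat
  assume p: "prime p" and "gcd p m = 1"
  then have "multiplicity p m = 0"
    by (metis coprime_iff_gcd_eq_1 coprime_absorb_left not_prime_unit not_dvd_imp_multiplicity_0)
  then show "f (p ^ k) = 1"
    using has_period_imp_prime_power_const[OF assms p, of k] multiplicative_one[OF f] by simp
qed

section \<open>The sum of \<open>f\<close> over greatest common divisors\<close>

definition gcd_sum :: "(nat \<Rightarrow> complex) \<Rightarrow> nat \<Rightarrow> complex" where
  "gcd_sum f n = (\<Sum>k\<in>{0<..n}. f (gcd k n))"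

lemma gcd_sum_eq_totient_convolution:
  assumes "n > 0"
  shows "gcd_sum f n = (\<Sum>d | d dvd n. f d * of_nat (totient (n div d)))"
proof -
  have "gcd_sum f n = (\<Sum>d | d dvd n. \<Sum>k\<in>{k\<in>{0<..n}. gcd k n = d}. f (gcd k n))"
    unfolding gcd_sum_def using assms by (intro sum.group[symmetric]) auto
  also have "\<dots> = (\<Sum>d | d dvd n. of_nat (card {k\<in>{0<..n}. gcd k n = d}) * f d)"
    by (intro sum.cong refl) simp
  also have "\<dots> = (\<Sum>d | d dvd n. f d * of_nat (totient (n div d)))"
    using assms by (intro sum.cong refl) (simp only: card_gcd_eq_totient mult.commute mem_Collect_eq)
  finally show ?thesis .
qed

lemma bij_betw_divisors_mult:
  fixes a b :: nat
  assumes "coprime a b"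
  shows "bij_betw (\<lambda>(x, y). x * y) ({x. x dvd a} \<times> {y. y dvd b}) {d. d dvd a * b}"
proof (rule bij_betwI')
  fix u v
  assume "u \<in> {x. x dvd a} \<times> {y. y dvd b}" "v \<in> {x. x dvd a} \<times> {y. y dvd b}"
  moreover have "coprime x y" if "x dvd a" "y dvd b" for x y
    using that assms by (rule coprime_divisors)
  ultimately show "((\<lambda>(x, y). x * y) u = (\<lambda>(x, y). x * y) v) = (u = v)"
    by (auto simp: coprime_crossproduct_nat)
next
  fix d assume "d \<in> {d. d dvd a * b}"
  then show "\<exists>u\<in>{x. x dvd a} \<times> {y. y dvd b}. d = (\<lambda>(x, y). x * y) u"
    using division_decomp[of d a b] by auto
qed (auto intro: mult_dvd_mono)

lemma multiplicative_gcd_sum: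
  assumes f: "multiplicative f"
  shows "multiplicative (gcd_sum f)"
  unfolding multiplicative_def
proof (intro conjI allI impI)
  have "{0<..1} = {1::nat}" by auto
  then show "gcd_sum f 1 = 1"
    using multiplicative_one[OF f] by (simp add: gcd_sum_def)
next
  fix a b :: nat
  assume ab: "0 < a" "0 < b" "coprime a b"
  have summand: "f (x * y) * of_nat (totient (a * b div (x * y))) =
      (f x * of_nat (totient (a div x))) * (f y * of_nat (totient (b div y)))"
    if x: "x dvd a" and y: "y dvd b" for x y
  proof -
    have pos: "x > 0" "y > 0"
      using x y ab by (auto intro: Nat.gr0I)
    have "coprime x y"
      using x y ab(3) by (rule coprime_divisors)
    then have "f (x * y) = f x * f y"
      using pos by (intro multiplicative_mult[OF f])
    moreover have "a div x dvd a" "b div y dvd b"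
      using x y by (metis dvd_div_mult_self dvd_triv_left)+
    then have "coprime (a div x) (b div y)"
      using ab(3) by (rule coprime_divisors)
    then have "totient (a * b div (x * y)) = totient (a div x) * totient (b div y)"
      using x y by (simp add: div_mult_div_if_dvd[symmetric] totient_mult_coprime)
    ultimately show ?thesis by simp
  qed
  have "gcd_sum f (a * b) = (\<Sum>d | d dvd a * b. f d * of_nat (totient (a * b div d)))"
    using ab by (intro gcd_sum_eq_totient_convolution) simp
  also have "\<dots> = (\<Sum>(x, y)\<in>{x. x dvd a} \<times> {y. y dvd b}.
      f (x * y) * of_nat (totient (a * b div (x * y))))"
    by (subst sum.reindex_bij_betw[OF bij_betw_divisors_mult[OF ab(3)], symmetric])
       (simp add: case_prod_beta)
  also have "\<dots> = (\<Sum>(x, y)\<in>{x. x dvd a} \<times> {y. y dvd b}.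
      (f x * of_nat (totient (a div x))) * (f y * of_nat (totient (b div y))))"
    by (intro sum.cong refl) (auto simp only: case_prod_beta fst_conv snd_conv
        mem_Collect_eq mem_Times_iff summand)
  also have "\<dots> = gcd_sum f a * gcd_sum f b"
    using ab by (simp add: gcd_sum_eq_totient_convolution sum_product sum.cartesian_product)
  finally show "gcd_sum f (a * b) = gcd_sum f a * gcd_sum f b" .
qed

lemma gcd_sum_eq_0_iff:
  assumes "multiplicative f" and "m > 0"
  shows "gcd_sum f m = 0 \<longleftrightarrow> (\<exists>p. prime p \<and> p dvd m \<and> gcd_sum f (p ^ multiplicity p m) = 0)"
proof -
  have "gcd_sum f m = (\<Prod>p\<in>prime_factors m. gcd_sum f (p ^ multiplicity p m))"
    using assms by (intro multiplicative_prime_factorization multiplicative_gcd_sum) auto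
  then show ?thesis
    using \<open>m > 0\<close> by (auto simp: prime_factors_dvd)
qed

text \<open>
  For \<open>k < a\<close> the totient of \<open>p ^ (a - k)\<close> is \<open>p ^ a * (1 - 1 / p) / p ^ k\<close>, while the one
  remaining term \<open>f (p ^ a)\<close> of the convolution is \<open>p ^ a * (1 - 1 / p)\<close> times the geometric
  tail \<open>\<Sum>k\<ge>a. f (p ^ a) / p ^ k\<close>.
\<close>

lemma prime_power_series_sums:
  fixes f :: "nat \<Rightarrow> complex"
  assumes p: "prime p" and const: "\<And>k. k \<ge> a \<Longrightarrow> f (p ^ k) = f (p ^ a)"
  shows "(\<lambda>k. f (p ^ k) / of_nat (p ^ k)) sums
           (gcd_sum f (p ^ a) / (of_nat (p ^ a) * (1 - 1 / of_nat p)))"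
proof -
  define c where "c = (of_nat p :: complex)"
  have "p > 1"
    using p by (rule prime_gt_1_nat)
  then have "norm c > 1" by (simp add: c_def)
  then have c: "c \<noteq> 0" "1 - 1 / c \<noteq> 0" "norm (1 / c) < 1"
    by (auto simp: norm_divide divide_less_eq)
  \<comment> \<open>The index shift \<open>a = Suc j + k\<close> keeps the exponent of the totient positive.\<close>
  have tot: "of_nat (totient (p ^ (a - k))) = c ^ a * (1 - 1 / c) / c ^ k" if k: "k < a" for k
  proof -
    obtain j where j: "a = Suc j + k"
      using k by (metis less_imp_Suc_add add.commute add_Suc)
    have "of_nat (totient (p ^ (a - k))) = c ^ j * (c - 1)"
      using p \<open>p > 1\<close> unfolding j c_def
      by (simp add: totient_prime_power_Suc of_nat_diff del: power_Suc)
    also have "\<dots> = c ^ a * (1 - 1 / c) / c ^ k"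
      using c(1) by (simp add: j power_add field_simps)
    finally show ?thesis .
  qed
  have "{d. d dvd p ^ a} = (\<lambda>k. p ^ k) ` {..a}"
    using p by (auto simp: divides_primepow_nat)
  moreover have "inj_on (\<lambda>k. p ^ k) {..a}"
    using \<open>p > 1\<close> by (auto simp: inj_on_def)
  ultimately have "gcd_sum f (p ^ a) = (\<Sum>k\<le>a. f (p ^ k) * of_nat (totient (p ^ a div p ^ k)))"
    using \<open>p > 1\<close> by (simp add: gcd_sum_eq_totient_convolution sum.reindex)
  also have "\<dots> = (\<Sum>k\<le>a. f (p ^ k) * of_nat (totient (p ^ (a - k))))"
    using \<open>p > 1\<close> by (intro sum.cong refl) (simp add: power_diff)
  also have "\<dots> = (\<Sum>k<a. f (p ^ k) * of_nat (totient (p ^ (a - k)))) + f (p ^ a)"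
    by (simp flip: lessThan_Suc_atMost)
  also have "\<dots> = c ^ a * (1 - 1 / c) * (\<Sum>k<a. f (p ^ k) / c ^ k) + f (p ^ a)"
    by (simp add: tot sum_distrib_left mult_ac)
  finally have G: "gcd_sum f (p ^ a) / (c ^ a * (1 - 1 / c)) =
      f (p ^ a) / c ^ a * (1 / (1 - 1 / c)) + (\<Sum>k<a. f (p ^ k) / c ^ k)"
    using c by (simp add: add_divide_distrib)
  have "(\<lambda>k. f (p ^ a) / c ^ a * (1 / c) ^ k) sums (f (p ^ a) / c ^ a * (1 / (1 - 1 / c)))"
    using c(3) by (intro sums_mult geometric_sums)
  moreover have "f (p ^ (k + a)) / c ^ (k + a) = f (p ^ a) / c ^ a * (1 / c) ^ k" for k
    using const[of "k + a"] by (simp add: power_add power_divide mult.commute)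
  ultimately have "(\<lambda>k. f (p ^ (k + a)) / c ^ (k + a)) sums (f (p ^ a) / c ^ a * (1 / (1 - 1 / c)))"
    by simp
  then have "(\<lambda>k. f (p ^ k) / c ^ k) sums (gcd_sum f (p ^ a) / (c ^ a * (1 - 1 / c)))"
    unfolding G by (rule sums_iff_shift[of "\<lambda>k. f (p ^ k) / c ^ k", THEN iffD1])
  then show ?thesis
    by (simp add: c_def)
qed

lemma condition_i_iff_gcd_sum_eq_0:
  assumes "multiplicative f" and "m > 0" and ii: "condition_ii m f"
  shows "condition_i m f \<longleftrightarrow> gcd_sum f m = 0"
proof -
  have "(\<lambda>k. f (p ^ k) / of_nat (p ^ k)) sums 0 \<longleftrightarrow> gcd_sum f (p ^ multiplicity p m) = 0"
    if p: "prime p" "p dvd m" for p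
  proof -
    have "multiplicity p m \<ge> 1"
      using p \<open>m > 0\<close> by (simp add: prime_multiplicity_gt_zero_iff Suc_le_eq)
    then have "(\<lambda>k. f (p ^ k) / of_nat (p ^ k)) sums
        (gcd_sum f (p ^ multiplicity p m) / (of_nat (p ^ multiplicity p m) * (1 - 1 / of_nat p)))"
      (is "?s sums (?G / ?d)")
      using ii p(1) unfolding condition_ii_def by (intro prime_power_series_sums) blast+
    moreover have "?d \<noteq> (0 :: complex)"
      using prime_gt_1_nat[OF p(1)] by auto
    moreover have "?s sums x \<Longrightarrow> ?s sums 0 \<longleftrightarrow> x = 0" for x
      by (auto dest: sums_unique2)
    ultimately show ?thesis
      by (simp only: divide_eq_0_iff simp_thms)
  qed
  then show ?thesis
    using assms(1,2) by (auto simp: condition_i_def gcd_sum_eq_0_iff)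
qed

section \<open>Partial sums of periodic functions\<close>

lemma bounded_partial_sums_iff:
  "bounded_partial_sums f \<longleftrightarrow> (\<exists>C. \<forall>n. norm (\<Sum>k\<in>{0<..n}. f k) \<le> C)"
proof
  assume "bounded_partial_sums f"
  then obtain C where C: "C > 0" "\<And>x::real. x \<ge> 1 \<Longrightarrow> norm (\<Sum>n | 0 < n \<and> real n \<le> x. f n) \<le> C"
    unfolding bounded_partial_sums_def by blast
  have "norm (\<Sum>k\<in>{0<..n}. f k) \<le> C" for n
  proof (cases "n = 0")
    case False
    have "{k. 0 < k \<and> real k \<le> real n} = {0<..n}" by auto
    then show ?thesis
      using C(2)[of "real n"] False by simp
  qed (use C(1) in simp)
  then show "\<exists>C. \<forall>n. norm (\<Sum>k\<in>{0<..n}. f k) \<le> C" by blast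
next
  assume "\<exists>C. \<forall>n. norm (\<Sum>k\<in>{0<..n}. f k) \<le> C"
  then obtain C where C: "norm (\<Sum>k\<in>{0<..n}. f k) \<le> C" for n by blast
  have "norm (\<Sum>n | 0 < n \<and> real n \<le> x. f n) \<le> max C 1" if "x \<ge> 1" for x :: real
  proof -
    have "{n. 0 < n \<and> real n \<le> x} = {0<..nat \<lfloor>x\<rfloor>}"
      using that by (auto simp: le_nat_floor) linarith
    then show ?thesis
      using C[of "nat \<lfloor>x\<rfloor>"] by simp
  qed
  then show "bounded_partial_sums f"
    unfolding bounded_partial_sums_def by (intro exI[of _ "max C 1"]) auto
qed

lemma sum_periodic_shift:
  assumes "has_period f m"
  shows "(\<Sum>k\<in>{0<..n + m}. f k) = (\<Sum>k\<in>{0<..n}. f k) + (\<Sum>k\<in>{0<..m}. f k)"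
proof (induction n)
  case (Suc n)
  have "f (Suc n + m) = f (Suc n)"
    using assms by (simp only: has_period_def)
  moreover have "{0<..Suc i} = insert (Suc i) {0<..i}" for i by auto
  ultimately show ?case
    using Suc by (simp add: algebra_simps)
qed simp

text \<open>
  Every period adds the same amount to the partial sums, so they grow linearly unless that amount
  is zero, in which case they are periodic themselves.
\<close>

lemma periodic_bounded_partial_sums_iff:
  assumes per: "has_period f m" and "m > 0"
  shows "bounded_partial_sums f \<longleftrightarrow> (\<Sum>k\<in>{0<..m}. f k) = 0"
proof -
  define A where "A n = (\<Sum>k\<in>{0<..n}. f k)" for n
  have step: "A (n + m) = A n + A m" for n
    unfolding A_def by (rule sum_periodic_shift[OF per])
  have mult: "A (n + j * m) = A n + of_nat j * A m" for n j
  proof (induction j)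
    case (Suc j)
    then show ?case
      using step[of "n + j * m"] by (simp add: algebra_simps)
  qed simp
  have "(\<exists>C. \<forall>n. norm (A n) \<le> C) \<longleftrightarrow> A m = 0"
  proof
    assume "\<exists>C. \<forall>n. norm (A n) \<le> C"
    then obtain C where C: "norm (A n) \<le> C" for n by blast
    show "A m = 0"
    proof (rule ccontr)
      assume "A m \<noteq> 0"
      then obtain j :: nat where "C < real j * norm (A m)"
        using reals_Archimedean3[of "norm (A m)"] by auto
      moreover have "norm (A (j * m)) = real j * norm (A m)"
        using mult[of 0 j] by (simp add: A_def norm_mult)
      ultimately show False
        using C[of "j * m"] by simp
    qed
  next
    assume "A m = 0"
    then have "A n = A (n mod m)" for n
      using mult[of "n mod m" "n div m"] by simp
    then have "norm (A n) \<le> Max ((\<lambda>r. norm (A r)) ` {..<m})" for n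
      using \<open>m > 0\<close> by (metis Max_ge finite_imageI finite_lessThan imageI lessThan_iff mod_less_divisor)
    then show "\<exists>C. \<forall>n. norm (A n) \<le> C" by blast
  qed
  then show ?thesis
    by (simp add: bounded_partial_sums_iff A_def)
qed

section \<open>The characterization\<close>

text \<open>
  Conditions (ii) and (iii) identify the sum of \<open>f\<close> over a period with \<open>gcd_sum f m\<close>, so
  they reduce both directions of the theorem to the equivalence stated here.
\<close>

lemma conditions_imp_periodic_and_bounded_iff:
  assumes f: "multiplicative f" and m: "m > 0" and ii: "condition_ii m f" and iii: "condition_iii m f"
  shows "has_period f m" and "bounded_partial_sums f \<longleftrightarrow> condition_i m f"
proof -
  note gcd = conditions_imp_depends_on_gcd[OF f m ii iii]
  have "f (n + m) = f n" if "n > 0" for n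
    using gcd[of n] gcd[of "n + m"] that by simp
  then show per: "has_period f m"
    by (simp add: has_period_def)
  have "(\<Sum>k\<in>{0<..m}. f k) = gcd_sum f m"
    unfolding gcd_sum_def by (intro sum.cong refl gcd) simp
  then show "bounded_partial_sums f \<longleftrightarrow> condition_i m f"
    by (simp add: periodic_bounded_partial_sums_iff[OF per m] condition_i_iff_gcd_sum_eq_0[OF f m ii])
qed

theorem theorem1p2:
  fixes m :: nat and f :: "nat \<Rightarrow> complex"
  assumes "m > 0" and "multiplicative f"
  shows "(has_period f m \<and> f m \<noteq> 0 \<and> bounded_partial_sums f \<longrightarrow>
            condition_i m f \<and> condition_ii m f \<and> condition_iii m f) \<and>
         (condition_i m f \<and> condition_ii m f \<and> condition_iii m f \<longrightarrow>
            has_period f m \<and> bounded_partial_sums f)"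
  using conditions_imp_periodic_and_bounded_iff[OF assms(2,1)]
    has_period_imp_condition_ii[OF assms(2) _ assms(1)]
    has_period_imp_condition_iii[OF assms(2) _ assms(1)]
  by blast

end
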